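(* Let $Q$ be a rack, $Y$ a $Q$-set, $A$ an abelian group, $k\in\mathbb{Z}_{>0}\cup\{\infty\}$, and let $\theta:C_2^{\mathrm R}(Q)_Y\to A$ be a shadow rack 2-cocycle. For $\upsilon\in Y$, $a,b\in Q$ and $i,j\in\mathbb{Z}\setminus\{0\}$ set $$\theta_{\upsilon;\,a,i;\,b,j}=\sum_{p=1}^{|i|}\sum_{q=1}^{|j|}\theta\big(\langle\upsilon\star^{p-1}a\star^{q-1}b\rangle\langle a*^{q-1}b\rangle\langle b\rangle\big).$$ Let $X=Q\times\mathbb{Z}_{k\operatorname{type}Q_Y}$ be the associated multiple group rack, and regard $Y$ as an $X$-set via $\upsilon\star(a,i)=\upsilon\star^ia$. (1) Suppose $k\operatorname{type}Q_Y=\infty$, so $X=Q\times\mathbb{Z}$. Define a 2-cochain $\widetilde\theta:C_2(X)_Y\to A$ on generators by $$\widetilde\theta(\langle\upsilon\rangle\langle(a,i)\rangle\langle(b,j)\rangle)=\begin{cases}\theta_{\upsilon;\,a,i;\,b,j}&(i>0,\ j>0),\\-\theta_{\upsilon\star^jb;\,a*^jb,i;\,b,-j}&(i>0,\ j<0),\\-\theta_{\upsilon\star^ia;\,a,-i;\,b,j}&(i<0,\ j>0),\\\theta_{\upsilon\star^ia\star^jb;\,a*^jb,-i;\,b,-j}&(i<0,\ j<0),\\0&(\text{otherwise}),\end{cases}\qquad \widetilde\theta(\langle\upsilon\rangle\langle(c,i),(c,j)\rangle)=0.$$ Then $\widetilde\theta$ is a shadow MGR 2-cocycle. (2) Suppose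 $k\operatorname{type}Q_Y\neq\infty$. Define a 2-cochain $\widetilde\theta:C_2(X)_Y\to A$ on generators by $$\widetilde\theta(\langle\upsilon\rangle\langle(a,i)\rangle\langle(b,j)\rangle)=\theta_{\upsilon;\,a,i;\,b,j},\qquad\widetilde\theta(\langle\upsilon\rangle\langle(c,i),(c,j)\rangle)=0,$$ where the elements of $\mathbb{Z}_{k\operatorname{type}Q_Y}$ are represented by integers $i,j$ with $1\le i\le k\operatorname{type}Q_Y$ and $1\le j\le k\operatorname{type}Q_Y$. (i) $\widetilde\theta$ is a shadow MGR 2-cocycle if for all $\upsilon\in Y$ and $a,b\in Q$ $$\sum_{p=1}^{k\operatorname{type}Q_Y}\theta(\langle\upsilon\star^{p-1}a\rangle\langle a\rangle\langle b\rangle)=0\quad\text{and}\quad\sum_{q=1}^{k\operatorname{type}Q_Y}\theta(\langle\upsilon\star^{q-1}b\rangle\langle a*^{q-1}b\rangle\langle b\rangle)=0.$$ (ii) $\widetilde\theta$ is a shadow MGR 2-cocycle if $k\alpha=0$ for every $\alpha\in A$. In particular, $\widetilde\theta$ is a shadow MGR 2-cocycle if $A$ is finite and $k=\#A$.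
   Context: Racks. A rack is a non-empty set $Q$ with a binary operation $*$ such that $S_a:x\mapsto x*a$ is bijective for every $a\in Q$ and $(a*b)*c=(a*c)*(b*c)$. A $Q$-set is a non-empty set $Y$ with a map $\star:Y\times Q\to Y$ such that $T_a:\upsilon\mapsto\upsilon\star a$ is bijective for every $a\in Q$ and $(\upsilon\star a)\star b=(\upsilon\star b)\star(a*b)$. For $i\in\mathbb{Z}$ write $b*^ia=S_a^i(b)$, $\upsilon\star^ia=T_a^i(\upsilon)$; iterated expressions are read from left to right. Put $$\operatorname{type}Q_Y=\min\{n>0\mid a*^nb=a\ \forall a,b\in Q,\ \upsilon\star^nc=\upsilon\ \forall\upsilon\in Y,c\in Q\},$$ with $\min\emptyset=\infty$; $k\operatorname{type}Q_Y=\infty$ if either factor is $\infty$. $C_2^{\mathrm R}(Q)_Y$ is the free abelian group on the symbols $\langle\upsilon\rangle\langle a\rangle\langle b\rangle$ ($\upsilon\in Y$, $a,b\in Q$). A homomorphism $\theta:C_2^{\mathrm R}(Q)_Y\to A$ is a shadow rack 2-cocycle if for all $\upsilon\in Y$, $a,b,c\in Q$: $$\theta(\langle\upsilon\star a\rangle\langle b\rangle\langle c\rangle+\langle\upsilon\rangle\langle a\rangle\langle c\rangle+\langle\upsilon\star c\rangle\langle a*c\rangle\langle b*c\rangle)=\theta(\langle\upsilon\rangle\langle b\rangle\langle c\rangle+\langle\upsilon\star b\rangle\langle a*b\rangle\langle c\rangle+\langle\upsilon\rangle\langle a\rangle\langle b\rangle).$$ MGRs. A multiple group rack (MGR) $X=\bigsqcup_{\lambda\in\Lambda}G_\lambda$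 is a disjoint union of groups with a binary operation $*:X^2\to X$ such that: $x*(y_1y_2)=(x*y_1)*y_2$ and $x*e_\lambda=x$ for $x\in X$, $y_1,y_2\in G_\lambda$ ($e_\lambda$ the identity of $G_\lambda$); $(x*y)*z=(x*z)*(y*z)$; and for $x_1,x_2\in G_\lambda$, $y\in X$, the elements $x_1*y,x_2*y$ lie in a common $G_\mu$ with $(x_1x_2)*y=(x_1*y)(x_2*y)$. An $X$-set is a non-empty set $Y$ with $\star:Y\times X\to Y$ such that $\upsilon\star e_\lambda=\upsilon$, $\upsilon\star(x_1x_2)=(\upsilon\star x_1)\star x_2$ for $x_1,x_2\in G_\lambda$, and $(\upsilon\star x)\star y=(\upsilon\star y)\star(x*y)$. Associated MGR. With $\mathbb{Z}_n=\mathbb{Z}/n\mathbb{Z}$, $\mathbb{Z}_\infty=\mathbb{Z}$ and $N=k\operatorname{type}Q_Y$, it is $Q\times\mathbb{Z}_N=\bigsqcup_{a\in Q}(\{a\}\times\mathbb{Z}_N)$ with $(a,i)*(b,j)=(a*^jb,i)$ and $(a,i)(a,j)=(a,i+j)$. MGR cocycles. $C_2(X)_Y$ is the free abelian group on the symbols $\langle\upsilon\rangle\langle x\rangle\langle y\rangle$ ($\upsilon\in Y$, $x,y\in X$) and $\langle\upsilon\rangle\langle x_1,x_2\rangle$ ($\upsilon\in Y$, $x_1,x_2$ in a common $G_\lambda$). A 2-cochain is a homomorphism $\theta:C_2(X)_Y\to A$; it is a shadow MGR 2-cocycle if for all $\upsilon\in Y$: (a) $\theta(\langle\upsilon\star x\rangle\langle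 y\rangle\langle z\rangle+\langle\upsilon\rangle\langle x\rangle\langle z\rangle+\langle\upsilon\star z\rangle\langle x*z\rangle\langle y*z\rangle)=\theta(\langle\upsilon\rangle\langle y\rangle\langle z\rangle+\langle\upsilon\star y\rangle\langle x*y\rangle\langle z\rangle+\langle\upsilon\rangle\langle x\rangle\langle y\rangle)$ for $x,y,z\in X$; (b) $\theta(\langle\upsilon\star x\rangle\langle y_1,y_2\rangle+\langle\upsilon\rangle\langle x\rangle\langle y_1y_2\rangle)=\theta(\langle\upsilon\rangle\langle y_1,y_2\rangle+\langle\upsilon\star y_1\rangle\langle x*y_1\rangle\langle y_2\rangle+\langle\upsilon\rangle\langle x\rangle\langle y_1\rangle)$ for $x\in X$, $y_1,y_2\in G_\lambda$; (c) $\theta(\langle\upsilon\star x_1\rangle\langle x_2\rangle\langle y\rangle+\langle\upsilon\rangle\langle x_1\rangle\langle y\rangle+\langle\upsilon\star y\rangle\langle x_1*y,x_2*y\rangle)=\theta(\langle\upsilon\rangle\langle x_1x_2\rangle\langle y\rangle+\langle\upsilon\rangle\langle x_1,x_2\rangle)$ for $x_1,x_2\in G_\lambda$, $y\in X$; (d) $\theta(\langle\upsilon\star x_1\rangle\langle x_2,x_3\rangle+\langle\upsilon\rangle\langle x_1,x_2x_3\rangle)=\theta(\langle\upsilon\rangle\langle x_1x_2,x_3\rangle+\langle\upsilon\rangle\langle x_1,x_2\rangle)$ for $x_1,x_2,x_3\in G_\lambda$. *)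

theory Defs
  imports "HOL-Algebra.Free_Abelian_Groups" "HOL-Library.Extended_Nat"
begin

section \<open>Racks and rack sets\<close>

text \<open>
  Integer powers of a bijection of a set \<open>S\<close>; on \<open>S\<close> this is the group-theoretic power \<open>f\<^sup>i\<close>.
  The inverse is taken relative to \<open>S\<close>, because \<open>f\<close> is unconstrained outside \<open>S\<close>.
\<close>

definition zpow :: "'a set \<Rightarrow> ('a \<Rightarrow> 'a) \<Rightarrow> int \<Rightarrow> 'a \<Rightarrow> 'a" where
  "zpow S f i x = (if 0 \<le> i then (f ^^ nat i) x else (inv_into S f ^^ nat (- i)) x)"

text \<open>
  \<open>iter_op S f x i a\<close> is \<open>S\<^sub>a\<^sup>i(x)\<close> where \<open>S\<^sub>a = (\<lambda>y. f y a)\<close>. It serves both for the powers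
  \<open>b *\<^sup>i a\<close> in a rack (\<open>S = Q\<close>) and for the powers \<open>\<upsilon> \<star>\<^sup>i a\<close> in a rack set (\<open>S = Y\<close>).
\<close>

definition iter_op :: "'s set \<Rightarrow> ('s \<Rightarrow> 'q \<Rightarrow> 's) \<Rightarrow> 's \<Rightarrow> int \<Rightarrow> 'q \<Rightarrow> 's" where
  "iter_op S f x i a = zpow S (\<lambda>y. f y a) i x"

locale rack =
  fixes Q :: "'q set" and opr :: "'q \<Rightarrow> 'q \<Rightarrow> 'q"
  assumes Q_nonempty: "Q \<noteq> {}"
    and opr_bij: "a \<in> Q \<Longrightarrow> bij_betw (\<lambda>x. opr x a) Q Q"
    and opr_distrib: "\<lbrakk>a \<in> Q; b \<in> Q; c \<in> Q\<rbrakk> \<Longrightarrow> opr (opr a b) c = opr (opr a c) (opr b c)"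

locale rack_set = rack Q opr for Q :: "'q set" and opr :: "'q \<Rightarrow> 'q \<Rightarrow> 'q" +
  fixes Y :: "'y set" and act :: "'y \<Rightarrow> 'q \<Rightarrow> 'y"
  assumes Y_nonempty: "Y \<noteq> {}"
    and act_bij: "a \<in> Q \<Longrightarrow> bij_betw (\<lambda>u. act u a) Y Y"
    and act_act: "\<lbrakk>u \<in> Y; a \<in> Q; b \<in> Q\<rbrakk> \<Longrightarrow> act (act u a) b = act (act u b) (opr a b)"

text \<open>On \<open>enat\<close> the infimum of the empty set is \<open>\<infinity>\<close>.\<close>

definition rack_type :: "'q set \<Rightarrow> ('q \<Rightarrow> 'q \<Rightarrow> 'q) \<Rightarrow> 'y set \<Rightarrow> ('y \<Rightarrow> 'q \<Rightarrow> 'y) \<Rightarrow> enat" where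
  "rack_type Q opr Y act =
     Inf {enat n | n. 0 < n \<and> (\<forall>a\<in>Q. \<forall>b\<in>Q. iter_op Q opr a (int n) b = a)
                        \<and> (\<forall>u\<in>Y. \<forall>c\<in>Q. iter_op Y act u (int n) c = u)}"

text \<open>
  The coefficient group \<open>A\<close> is a \<^locale>\<open>comm_group\<close>, hence written multiplicatively: a sum in
  \<open>A\<close> appears as \<^const>\<open>finprod\<close>, \<open>0\<close> as \<open>\<one>\<^bsub>A\<^esub>\<close>, and \<open>k\<alpha>\<close> as \<open>\<alpha> [^]\<^bsub>A\<^esub> k\<close>. The chain groups are
  instances of \<^const>\<open>free_Abelian_group\<close>, whose group operation is \<open>+\<close> on finitely supported
  integer-valued functions. The symbol \<open>\<langle>\<upsilon>\<rangle>\<langle>a\<rangle>\<langle>b\<rangle>\<close> is the triple \<open>(\<upsilon>, a, b)\<close>.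
\<close>

definition shadow_rack_2cocycle ::
  "'q set \<Rightarrow> ('q \<Rightarrow> 'q \<Rightarrow> 'q) \<Rightarrow> 'y set \<Rightarrow> ('y \<Rightarrow> 'q \<Rightarrow> 'y) \<Rightarrow> ('g, 'm) monoid_scheme
    \<Rightarrow> (('y \<times> 'q \<times> 'q \<Rightarrow>\<^sub>0 int) \<Rightarrow> 'g) \<Rightarrow> bool" where
  "shadow_rack_2cocycle Q opr Y act A \<theta> \<longleftrightarrow>
     \<theta> \<in> hom (free_Abelian_group (Y \<times> Q \<times> Q)) A \<and>
     (\<forall>u\<in>Y. \<forall>a\<in>Q. \<forall>b\<in>Q. \<forall>c\<in>Q.
        \<theta> (frag_of (act u a, b, c) + frag_of (u, a, c) + frag_of (act u c, opr a c, opr b c)) =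
        \<theta> (frag_of (u, b, c) + frag_of (act u b, opr a b, c) + frag_of (u, a, b)))"

section \<open>Multiple group racks\<close>

definition mgr_carrier :: "'l set \<Rightarrow> ('l \<Rightarrow> 'x monoid) \<Rightarrow> 'x set" where
  "mgr_carrier \<Lambda> G = (\<Union>l\<in>\<Lambda>. carrier (G l))"

locale multiple_group_rack =
  fixes \<Lambda> :: "'l set" and G :: "'l \<Rightarrow> 'x monoid" and opr :: "'x \<Rightarrow> 'x \<Rightarrow> 'x"
  assumes groups: "l \<in> \<Lambda> \<Longrightarrow> group (G l)"
    and disjoint: "\<lbrakk>l \<in> \<Lambda>; m \<in> \<Lambda>; l \<noteq> m\<rbrakk> \<Longrightarrow> carrier (G l) \<inter> carrier (G m) = {}"
    and opr_closed: "\<lbrakk>x \<in> mgr_carrier \<Lambda> G; y \<in> mgr_carrier \<Lambda> G\<rbrakk> \<Longrightarrow> opr x y \<in> mgr_carrier \<Lambda> G"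
    and opr_mult: "\<lbrakk>x \<in> mgr_carrier \<Lambda> G; l \<in> \<Lambda>; y1 \<in> carrier (G l); y2 \<in> carrier (G l)\<rbrakk>
          \<Longrightarrow> opr x (y1 \<otimes>\<^bsub>G l\<^esub> y2) = opr (opr x y1) y2"
    and opr_one: "\<lbrakk>x \<in> mgr_carrier \<Lambda> G; l \<in> \<Lambda>\<rbrakk> \<Longrightarrow> opr x \<one>\<^bsub>G l\<^esub> = x"
    and opr_distrib: "\<lbrakk>x \<in> mgr_carrier \<Lambda> G; y \<in> mgr_carrier \<Lambda> G; z \<in> mgr_carrier \<Lambda> G\<rbrakk>
          \<Longrightarrow> opr (opr x y) z = opr (opr x z) (opr y z)"
    and mult_opr: "\<lbrakk>l \<in> \<Lambda>; x1 \<in> carrier (G l); x2 \<in> carrier (G l); y \<in> mgr_carrier \<Lambda> G\<rbrakk>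
          \<Longrightarrow> \<exists>m\<in>\<Lambda>. opr x1 y \<in> carrier (G m) \<and> opr x2 y \<in> carrier (G m) \<and>
                opr (x1 \<otimes>\<^bsub>G l\<^esub> x2) y = opr x1 y \<otimes>\<^bsub>G m\<^esub> opr x2 y"

locale mgr_set = multiple_group_rack \<Lambda> G opr
  for \<Lambda> :: "'l set" and G :: "'l \<Rightarrow> 'x monoid" and opr :: "'x \<Rightarrow> 'x \<Rightarrow> 'x" +
  fixes Y :: "'y set" and act :: "'y \<Rightarrow> 'x \<Rightarrow> 'y"
  assumes Y_nonempty: "Y \<noteq> {}"
    and act_closed: "\<lbrakk>u \<in> Y; x \<in> mgr_carrier \<Lambda> G\<rbrakk> \<Longrightarrow> act u x \<in> Y"
    and act_one: "\<lbrakk>u \<in> Y; l \<in> \<Lambda>\<rbrakk> \<Longrightarrow> act u \<one>\<^bsub>G l\<^esub> = u"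
    and act_mult: "\<lbrakk>u \<in> Y; l \<in> \<Lambda>; x1 \<in> carrier (G l); x2 \<in> carrier (G l)\<rbrakk>
          \<Longrightarrow> act u (x1 \<otimes>\<^bsub>G l\<^esub> x2) = act (act u x1) x2"
    and act_act: "\<lbrakk>u \<in> Y; x \<in> mgr_carrier \<Lambda> G; y \<in> mgr_carrier \<Lambda> G\<rbrakk>
          \<Longrightarrow> act (act u x) y = act (act u y) (opr x y)"

text \<open>\<open>Cross \<upsilon> x y\<close> is \<open>\<langle>\<upsilon>\<rangle>\<langle>x\<rangle>\<langle>y\<rangle>\<close> and \<open>Join \<upsilon> x\<^sub>1 x\<^sub>2\<close> is \<open>\<langle>\<upsilon>\<rangle>\<langle>x\<^sub>1, x\<^sub>2\<rangle>\<close>.\<close>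

datatype ('y, 'x) mgr_sym = Cross 'y 'x 'x | Join 'y 'x 'x

abbreviation cross :: "'y \<Rightarrow> 'x \<Rightarrow> 'x \<Rightarrow> ('y, 'x) mgr_sym \<Rightarrow>\<^sub>0 int" where
  "cross u x y \<equiv> frag_of (Cross u x y)"

abbreviation join :: "'y \<Rightarrow> 'x \<Rightarrow> 'x \<Rightarrow> ('y, 'x) mgr_sym \<Rightarrow>\<^sub>0 int" where
  "join u x y \<equiv> frag_of (Join u x y)"

definition mgr_syms :: "'l set \<Rightarrow> ('l \<Rightarrow> 'x monoid) \<Rightarrow> 'y set \<Rightarrow> ('y, 'x) mgr_sym set" where
  "mgr_syms \<Lambda> G Y =
     {Cross u x y | u x y. u \<in> Y \<and> x \<in> mgr_carrier \<Lambda> G \<and> y \<in> mgr_carrier \<Lambda> G} \<union>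
     {Join u x1 x2 | u x1 x2. u \<in> Y \<and> (\<exists>l\<in>\<Lambda>. x1 \<in> carrier (G l) \<and> x2 \<in> carrier (G l))}"

definition shadow_mgr_2cocycle ::
  "'l set \<Rightarrow> ('l \<Rightarrow> 'x monoid) \<Rightarrow> ('x \<Rightarrow> 'x \<Rightarrow> 'x) \<Rightarrow> 'y set \<Rightarrow> ('y \<Rightarrow> 'x \<Rightarrow> 'y)
    \<Rightarrow> ('g, 'm) monoid_scheme \<Rightarrow> ((('y, 'x) mgr_sym \<Rightarrow>\<^sub>0 int) \<Rightarrow> 'g) \<Rightarrow> bool" where
  "shadow_mgr_2cocycle \<Lambda> G opr Y act A \<theta> \<longleftrightarrow>
     \<theta> \<in> hom (free_Abelian_group (mgr_syms \<Lambda> G Y)) A \<and>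
     (\<forall>u\<in>Y. \<forall>x\<in>mgr_carrier \<Lambda> G. \<forall>y\<in>mgr_carrier \<Lambda> G. \<forall>z\<in>mgr_carrier \<Lambda> G.
        \<theta> (cross (act u x) y z + cross u x z + cross (act u z) (opr x z) (opr y z)) =
        \<theta> (cross u y z + cross (act u y) (opr x y) z + cross u x y)) \<and>
     (\<forall>u\<in>Y. \<forall>x\<in>mgr_carrier \<Lambda> G. \<forall>l\<in>\<Lambda>. \<forall>y1\<in>carrier (G l). \<forall>y2\<in>carrier (G l).
        \<theta> (join (act u x) y1 y2 + cross u x (y1 \<otimes>\<^bsub>G l\<^esub> y2)) =
        \<theta> (join u y1 y2 + cross (act u y1) (opr x y1) y2 + cross u x y1)) \<and>
     (\<forall>u\<in>Y. \<forall>l\<in>\<Lambda>. \<forall>x1\<in>carrier (G l). \<forall>x2\<in>carrier (G l). \<forall>y\<in>mgr_carrier \<Lambda> G.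
        \<theta> (cross (act u x1) x2 y + cross u x1 y + join (act u y) (opr x1 y) (opr x2 y)) =
        \<theta> (cross u (x1 \<otimes>\<^bsub>G l\<^esub> x2) y + join u x1 x2)) \<and>
     (\<forall>u\<in>Y. \<forall>l\<in>\<Lambda>. \<forall>x1\<in>carrier (G l). \<forall>x2\<in>carrier (G l). \<forall>x3\<in>carrier (G l).
        \<theta> (join (act u x1) x2 x3 + join u x1 (x2 \<otimes>\<^bsub>G l\<^esub> x3)) =
        \<theta> (join u (x1 \<otimes>\<^bsub>G l\<^esub> x2) x3 + join u x1 x2))"

text \<open>The homomorphism on a free abelian group with prescribed values on the generators.\<close>

definition free_extend :: "('g, 'm) monoid_scheme \<Rightarrow> ('s \<Rightarrow> 'g) \<Rightarrow> ('s \<Rightarrow>\<^sub>0 int) \<Rightarrow> 'g" where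
  "free_extend A f c =
     finprod A (\<lambda>s. f s [^]\<^bsub>A\<^esub> Poly_Mapping.lookup c s) (Poly_Mapping.keys c)"

section \<open>The associated multiple group rack\<close>

text \<open>
  \<open>\<int>\<^sub>N\<close> for \<open>0 < N \<le> \<infinity>\<close>: for finite \<open>N\<close> the carrier is \<open>{0..<N}\<close> with addition modulo \<open>N\<close>.
\<close>

definition cyclic :: "enat \<Rightarrow> int monoid" where
  "cyclic N = (case N of enat n \<Rightarrow> integer_mod_group n | \<infinity> \<Rightarrow> integer_group)"

definition assoc_group :: "enat \<Rightarrow> 'q \<Rightarrow> ('q \<times> int) monoid" where
  "assoc_group N a =
     \<lparr>carrier = {a} \<times> carrier (cyclic N),
      monoid.mult = (\<lambda>x y. (a, snd x \<otimes>\<^bsub>cyclic N\<^esub> snd y)),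
      one = (a, \<one>\<^bsub>cyclic N\<^esub>)\<rparr>"

definition assoc_op :: "'q set \<Rightarrow> ('q \<Rightarrow> 'q \<Rightarrow> 'q) \<Rightarrow> 'q \<times> int \<Rightarrow> 'q \<times> int \<Rightarrow> 'q \<times> int" where
  "assoc_op Q opr = (\<lambda>(a, i) (b, j). (iter_op Q opr a j b, i))"

definition assoc_act :: "'y set \<Rightarrow> ('y \<Rightarrow> 'q \<Rightarrow> 'y) \<Rightarrow> 'y \<Rightarrow> 'q \<times> int \<Rightarrow> 'y" where
  "assoc_act Y act u = (\<lambda>(a, i). iter_op Y act u i a)"

section \<open>The cochains\<close>

definition theta_sum ::
  "'q set \<Rightarrow> ('q \<Rightarrow> 'q \<Rightarrow> 'q) \<Rightarrow> 'y set \<Rightarrow> ('y \<Rightarrow> 'q \<Rightarrow> 'y) \<Rightarrow> ('g, 'm) monoid_scheme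
    \<Rightarrow> (('y \<times> 'q \<times> 'q \<Rightarrow>\<^sub>0 int) \<Rightarrow> 'g) \<Rightarrow> 'y \<Rightarrow> 'q \<Rightarrow> int \<Rightarrow> 'q \<Rightarrow> int \<Rightarrow> 'g" where
  "theta_sum Q opr Y act A \<theta> u a i b j =
     (\<Otimes>\<^bsub>A\<^esub>p\<in>{1..\<bar>i\<bar>}. \<Otimes>\<^bsub>A\<^esub>q\<in>{1..\<bar>j\<bar>}.
        \<theta> (frag_of (iter_op Y act (iter_op Y act u (p - 1) a) (q - 1) b,
                    iter_op Q opr a (q - 1) b, b)))"

definition theta_infinite ::
  "'q set \<Rightarrow> ('q \<Rightarrow> 'q \<Rightarrow> 'q) \<Rightarrow> 'y set \<Rightarrow> ('y \<Rightarrow> 'q \<Rightarrow> 'y) \<Rightarrow> ('g, 'm) monoid_scheme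
    \<Rightarrow> (('y \<times> 'q \<times> 'q \<Rightarrow>\<^sub>0 int) \<Rightarrow> 'g) \<Rightarrow> (('y, 'q \<times> int) mgr_sym \<Rightarrow>\<^sub>0 int) \<Rightarrow> 'g" where
  "theta_infinite Q opr Y act A \<theta> = free_extend A (\<lambda>s. case s of
     Cross u (a, i) (b, j) \<Rightarrow>
       (if i > 0 \<and> j > 0 then theta_sum Q opr Y act A \<theta> u a i b j
        else if i > 0 \<and> j < 0 then
          inv\<^bsub>A\<^esub> (theta_sum Q opr Y act A \<theta> (iter_op Y act u j b) (iter_op Q opr a j b) i b (- j))
        else if i < 0 \<and> j > 0 then
          inv\<^bsub>A\<^esub> (theta_sum Q opr Y act A \<theta> (iter_op Y act u i a) a (- i) b j)
        else if i < 0 \<and> j < 0 then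
          theta_sum Q opr Y act A \<theta> (iter_op Y act (iter_op Y act u i a) j b)
            (iter_op Q opr a j b) (- i) b (- j)
        else \<one>\<^bsub>A\<^esub>)
   | Join u x y \<Rightarrow> \<one>\<^bsub>A\<^esub>)"

text \<open>
  Elements of \<open>\<int>\<^sub>n\<close> are stored as residues \<open>0, \<dots>, n - 1\<close>, but the finite cochain is defined through
  the representatives \<open>1, \<dots>, n\<close>.
\<close>

definition pos_rep :: "nat \<Rightarrow> int \<Rightarrow> int" where
  "pos_rep n i = (if i = 0 then int n else i)"

definition theta_finite ::
  "nat \<Rightarrow> 'q set \<Rightarrow> ('q \<Rightarrow> 'q \<Rightarrow> 'q) \<Rightarrow> 'y set \<Rightarrow> ('y \<Rightarrow> 'q \<Rightarrow> 'y) \<Rightarrow> ('g, 'm) monoid_scheme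
    \<Rightarrow> (('y \<times> 'q \<times> 'q \<Rightarrow>\<^sub>0 int) \<Rightarrow> 'g) \<Rightarrow> (('y, 'q \<times> int) mgr_sym \<Rightarrow>\<^sub>0 int) \<Rightarrow> 'g" where
  "theta_finite n Q opr Y act A \<theta> = free_extend A (\<lambda>s. case s of
     Cross u (a, i) (b, j) \<Rightarrow> theta_sum Q opr Y act A \<theta> u a (pos_rep n i) b (pos_rep n j)
   | Join u x y \<Rightarrow> \<one>\<^bsub>A\<^esub>)"


section \<open>Well-definedness of the construction\<close>

lemma zpow_0 [simp]: "zpow S f 0 x = x"
  by (simp add: zpow_def)

lemma zpow_Suc:
  assumes f: "bij_betw f S S" and x: "x \<in> S"
  shows "zpow S f (i + 1) x = f (zpow S f i x)" and "zpow S f i x \<in> S"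
proof -
  have pos: "(f ^^ n) x \<in> S" for n
    using f x by (induction n) (auto dest: bij_betwE)
  have neg: "(inv_into S f ^^ n) x \<in> S" for n
    using bij_betw_inv_into[OF f] x by (induction n) (auto dest: bij_betwE)
  show "zpow S f i x \<in> S"
    using pos neg by (simp add: zpow_def)
  show "zpow S f (i + 1) x = f (zpow S f i x)"
  proof (cases "0 \<le> i")
    case True
    then have "nat (i + 1) = Suc (nat i)" by simp
    then show ?thesis using True by (simp add: zpow_def)
  next
    case False
    then obtain n where n: "i = - int (Suc n)"
      by (metis int_cases not_le of_nat_0_le_iff)
    have "f (inv_into S f ((inv_into S f ^^ n) x)) = (inv_into S f ^^ n) x"
      using bij_betw_inv_into_right[OF f neg] .
    moreover have "nat (- (i + 1)) = n" "nat (- i) = Suc n"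
      using n by auto
    ultimately show ?thesis
      using n by (auto simp: zpow_def)
  qed
qed

lemma zpow_intertwine:
  assumes f: "bij_betw f S S" and h: "bij_betw h T T"
    and g: "\<And>x. x \<in> S \<Longrightarrow> g x \<in> T" and gf: "\<And>x. x \<in> S \<Longrightarrow> g (f x) = h (g x)"
    and x: "x \<in> S"
  shows "g (zpow S f i x) = zpow T h i (g x)"
proof (induction i rule: int_induct[where k = 0])
  case base
  then show ?case by simp
next
  case (step1 i)
  then show ?case
    by (simp add: zpow_Suc[OF f x] zpow_Suc(1)[OF h g[OF x]] gf)
next
  case (step2 i)
  have "h (g (zpow S f (i - 1) x)) = g (zpow S f i x)"
    using zpow_Suc[OF f x, of "i - 1"] by (simp add: gf)
  also have "\<dots> = h (zpow T h (i - 1) (g x))"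
    using zpow_Suc(1)[OF h g[OF x], of "i - 1"] step2 by simp
  finally show ?case
    using h g zpow_Suc(2)[OF f x] zpow_Suc(2)[OF h g[OF x]]
    by (auto simp: bij_betw_def dest: inj_onD)
qed

lemma zpow_add:
  assumes f: "bij_betw f S S" and x: "x \<in> S"
  shows "zpow S f (i + j) x = zpow S f j (zpow S f i x)"
proof (induction j rule: int_induct[where k = 0])
  case base
  then show ?case by simp
next
  case (step1 j)
  then show ?case
    using zpow_Suc(1)[OF f x, of "i + j"] zpow_Suc[OF f zpow_Suc(2)[OF f x]]
    by (simp add: add.assoc)
next
  case (step2 j)
  have "f (zpow S f (i + (j - 1)) x) = f (zpow S f (j - 1) (zpow S f i x))"
    using zpow_Suc(1)[OF f x, of "i + (j - 1)"] zpow_Suc(1)[OF f zpow_Suc(2)[OF f x], of "j - 1"] step2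
    by (simp add: algebra_simps)
  then show ?case
    using f zpow_Suc(2)[OF f x] zpow_Suc(2)[OF f zpow_Suc(2)[OF f x]]
    by (auto simp: bij_betw_def dest: inj_onD)
qed

lemma zpow_mod:
  assumes f: "bij_betw f S S" and x: "x \<in> S" and per: "\<And>y. y \<in> S \<Longrightarrow> zpow S f n y = y"
  shows "zpow S f (i mod n) x = zpow S f i x"
proof -
  have mult: "zpow S f (n * m) y = y" if y: "y \<in> S" for m y
  proof (induction m rule: int_induct[where k = 0])
    case base
    then show ?case by simp
  next
    case (step1 m)
    then show ?case using zpow_add[OF f y, of "n * m" n] per y by (simp add: algebra_simps)
  next
    case (step2 m)
    then show ?case
      using zpow_add[OF f y, of "n * (m - 1)" n] per zpow_Suc(2)[OF f y] by (simp add: algebra_simps)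
  qed
  have "zpow S f i x = zpow S f (n * (i div n) + i mod n) x" by simp
  also have "\<dots> = zpow S f (i mod n) x"
    using zpow_add[OF f x, of "n * (i div n)" "i mod n"] mult[OF x] by simp
  finally show ?thesis ..
qed

context rack_set
begin

lemma iter_op_Q_closed: "\<lbrakk>a \<in> Q; b \<in> Q\<rbrakk> \<Longrightarrow> iter_op Q opr a i b \<in> Q"
  unfolding iter_op_def using zpow_Suc(2)[OF opr_bij] by blast

lemma iter_op_Y_closed: "\<lbrakk>u \<in> Y; b \<in> Q\<rbrakk> \<Longrightarrow> iter_op Y act u i b \<in> Y"
  unfolding iter_op_def using zpow_Suc(2)[OF act_bij] by blast

text \<open>Conjugating an operator \<open>T\<^sub>a\<close> by \<open>S\<^sub>b\<^sup>j\<close>, simultaneously for the rack and for the rack set.\<close>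

lemma conjugate:
  assumes a: "a \<in> Q" and b: "b \<in> Q" and x: "x \<in> Z"
    and bij: "\<And>a. a \<in> Q \<Longrightarrow> bij_betw (\<lambda>y. f y a) Z Z"
    and comm: "\<And>x a b. \<lbrakk>x \<in> Z; a \<in> Q; b \<in> Q\<rbrakk> \<Longrightarrow> f (f x a) b = f (f x b) (opr a b)"
  shows "iter_op Z f (f x a) j b = f (iter_op Z f x j b) (iter_op Q opr a j b)"
proof -
  have fx: "f x c \<in> Z" if "x \<in> Z" "c \<in> Q" for x c
    using bij that by (blast dest: bij_betwE)
  note Zp = zpow_Suc[OF bij[OF b]] and Qp = zpow_Suc[OF opr_bij[OF b] a]
  show ?thesis
    unfolding iter_op_def
  proof (induction j rule: int_induct[where k = 0])
    case base
    then show ?case by simp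
  next
    case (step1 j)
    then show ?case
      using Zp[OF x] Zp(1)[OF fx[OF x a]] Qp b by (simp add: comm)
  next
    case (step2 j)
    let ?l = "zpow Z (\<lambda>y. f y b) (j - 1) (f x a)"
    let ?r = "f (zpow Z (\<lambda>y. f y b) (j - 1) x) (zpow Q (\<lambda>y. opr y b) (j - 1) a)"
    have "f ?l b = f ?r b"
      using Zp(1)[OF x, of "j - 1"] Zp(1)[OF fx[OF x a], of "j - 1"] Qp(1)[of "j - 1"] step2
        comm[OF Zp(2)[OF x] Qp(2) b, of "j - 1" "j - 1"]
      by simp
    moreover have "?l \<in> Z" "?r \<in> Z"
      using Zp(2) fx x a Qp(2) by auto
    ultimately show ?case
      using bij[OF b] by (auto simp: bij_betw_def dest: inj_onD)
  qed
qed

lemma iter_conjugate: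
  assumes a: "a \<in> Q" and b: "b \<in> Q" and x: "x \<in> Z"
    and bij: "\<And>a. a \<in> Q \<Longrightarrow> bij_betw (\<lambda>y. f y a) Z Z"
    and comm: "\<And>x a b. \<lbrakk>x \<in> Z; a \<in> Q; b \<in> Q\<rbrakk> \<Longrightarrow> f (f x a) b = f (f x b) (opr a b)"
  shows "iter_op Z f (iter_op Z f x i a) j b
       = iter_op Z f (iter_op Z f x j b) i (iter_op Q opr a j b)"
proof -
  let ?g = "\<lambda>x. iter_op Z f x j b"
  have "?g (zpow Z (\<lambda>y. f y a) i x) = zpow Z (\<lambda>y. f y (iter_op Q opr a j b)) i (?g x)"
  proof (rule zpow_intertwine[OF bij[OF a] bij[OF iter_op_Q_closed[OF a b]] _ _ x])
    show "?g y \<in> Z" if "y \<in> Z" for y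
      unfolding iter_op_def using zpow_Suc(2)[OF bij[OF b] that] .
    show "?g (f y a) = f (?g y) (iter_op Q opr a j b)" if "y \<in> Z" for y
      by (rule conjugate[OF a b that bij comm])
  qed
  then show ?thesis by (simp add: iter_op_def)
qed

lemma rack_type_period:
  assumes "enat n = k * rack_type Q opr Y act" "0 < k"
  shows "0 < n" and "\<lbrakk>a \<in> Q; b \<in> Q\<rbrakk> \<Longrightarrow> iter_op Q opr a (int n) b = a"
    and "\<lbrakk>u \<in> Y; b \<in> Q\<rbrakk> \<Longrightarrow> iter_op Y act u (int n) b = u"
proof -
  define P where "P m \<longleftrightarrow> 0 < m \<and> (\<forall>a\<in>Q. \<forall>b\<in>Q. iter_op Q opr a (int m) b = a)
                        \<and> (\<forall>u\<in>Y. \<forall>c\<in>Q. iter_op Y act u (int m) c = u)" for m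
  have type: "rack_type Q opr Y act = Inf {enat m | m. P m}"
    by (simp add: rack_type_def P_def)
  have "{enat m | m. P m} \<noteq> {}"
  proof
    assume "{enat m | m. P m} = {}"
    then have "rack_type Q opr Y act = \<infinity>" by (simp add: type top_enat_def)
    then show False using assms by (cases k) (auto simp: zero_enat_def split: if_splits)
  qed
  then have "rack_type Q opr Y act \<in> {enat m | m. P m}"
    unfolding type by (metis (no_types, lifting) Inf_enat_def LeastI ex_in_conv)
  then obtain m where m: "rack_type Q opr Y act = enat m" "P m" by blast
  with assms obtain l where l: "k = enat l"
    by (cases k) (auto simp: P_def zero_enat_def)
  then have n: "n = m * l" and "0 < l" using assms m by (auto simp: zero_enat_def)
  then show "0 < n" using m by (simp add: P_def)
  have *: "iter_op Z f x (int n) b = x"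
    if bij: "bij_betw (\<lambda>y. f y b) Z Z" and per: "\<forall>x\<in>Z. iter_op Z f x (int m) b = x" and x: "x \<in> Z"
    for Z and f :: "'z \<Rightarrow> 'q \<Rightarrow> 'z" and x b
    using zpow_mod[OF bij x, of "int m" "int n"] per x by (simp add: iter_op_def n)
  show "\<lbrakk>a \<in> Q; b \<in> Q\<rbrakk> \<Longrightarrow> iter_op Q opr a (int n) b = a"
    using *[of opr b Q a] opr_bij m by (simp add: P_def)
  show "\<lbrakk>u \<in> Y; b \<in> Q\<rbrakk> \<Longrightarrow> iter_op Y act u (int n) b = u"
    using *[of act b Y u] act_bij m by (simp add: P_def)
qed

lemma iter_op_cyclic:
  assumes N: "N = k * rack_type Q opr Y act" "0 < k" and b: "b \<in> Q"
  shows "a \<in> Q \<Longrightarrow> iter_op Q opr a (i \<otimes>\<^bsub>cyclic N\<^esub> j) b = iter_op Q opr (iter_op Q opr a i b) j b"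
    and "u \<in> Y \<Longrightarrow> iter_op Y act u (i \<otimes>\<^bsub>cyclic N\<^esub> j) b = iter_op Y act (iter_op Y act u i b) j b"
proof -
  have *: "iter_op Z f x (i \<otimes>\<^bsub>cyclic N\<^esub> j) b = iter_op Z f (iter_op Z f x i b) j b"
    if bij: "bij_betw (\<lambda>y. f y b) Z Z" and x: "x \<in> Z"
      and per: "\<And>n y. \<lbrakk>N = enat n; y \<in> Z\<rbrakk> \<Longrightarrow> iter_op Z f y (int n) b = y"
    for Z and f :: "'z \<Rightarrow> 'q \<Rightarrow> 'z" and x
    using zpow_add[OF bij x] zpow_mod[OF bij x, of "int (the_enat N)"] per
    by (cases N) (simp_all add: cyclic_def iter_op_def)
  show "a \<in> Q \<Longrightarrow> iter_op Q opr a (i \<otimes>\<^bsub>cyclic N\<^esub> j) b = iter_op Q opr (iter_op Q opr a i b) j b"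
    using *[of opr Q a, OF opr_bij[OF b]] rack_type_period(2)[OF _ N(2)] N(1) b by metis
  show "u \<in> Y \<Longrightarrow> iter_op Y act u (i \<otimes>\<^bsub>cyclic N\<^esub> j) b = iter_op Y act (iter_op Y act u i b) j b"
    using *[of act Y u, OF act_bij[OF b]] rack_type_period(3)[OF _ N(2)] N(1) b by metis
qed

lemma group_cyclic: "group (cyclic N)"
  by (cases N) (simp_all add: cyclic_def)

lemma one_cyclic: "\<one>\<^bsub>cyclic N\<^esub> = 0"
  by (cases N) (simp_all add: cyclic_def)

theorem assoc_mgr_set:
  assumes N: "N = k * rack_type Q opr Y act" "0 < k"
  shows "mgr_set Q (assoc_group N) (assoc_op Q opr) Y (assoc_act Y act)"
proof -
  interpret Z: group "cyclic N" by (rule group_cyclic)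
  have carrier: "mgr_carrier Q (assoc_group N) = Q \<times> carrier (cyclic N)"
    by (auto simp: mgr_carrier_def assoc_group_def)
  have grp: "group (assoc_group N a)" for a
    by (rule groupI) (auto simp: assoc_group_def Z.m_assoc intro: Z.l_inv_ex)
  have zero: "iter_op Z f x 0 b = x" for Z x b and f :: "'z \<Rightarrow> 'q \<Rightarrow> 'z"
    by (simp add: iter_op_def)
  show ?thesis
  proof (intro mgr_set.intro multiple_group_rack.intro mgr_set_axioms.intro)
    fix l x1 x2 y
    assume "l \<in> Q" "x1 \<in> carrier (assoc_group N l)" "x2 \<in> carrier (assoc_group N l)"
      "y \<in> mgr_carrier Q (assoc_group N)"
    then show "\<exists>m\<in>Q. assoc_op Q opr x1 y \<in> carrier (assoc_group N m) \<and>
        assoc_op Q opr x2 y \<in> carrier (assoc_group N m) \<and>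
        assoc_op Q opr (x1 \<otimes>\<^bsub>assoc_group N l\<^esub> x2) y
          = assoc_op Q opr x1 y \<otimes>\<^bsub>assoc_group N m\<^esub> assoc_op Q opr x2 y"
      unfolding carrier
      by (intro bexI[of _ "fst (assoc_op Q opr x1 y)"])
        (auto simp: assoc_group_def assoc_op_def iter_op_Q_closed)
  next
    fix x y z
    assume "x \<in> mgr_carrier Q (assoc_group N)" "y \<in> mgr_carrier Q (assoc_group N)"
      "z \<in> mgr_carrier Q (assoc_group N)"
    then show "assoc_op Q opr (assoc_op Q opr x y) z
        = assoc_op Q opr (assoc_op Q opr x z) (assoc_op Q opr y z)"
      unfolding carrier
      by (auto simp: assoc_op_def intro!: iter_conjugate opr_bij opr_distrib)
  next
    fix u x y
    assume "u \<in> Y" "x \<in> mgr_carrier Q (assoc_group N)" "y \<in> mgr_carrier Q (assoc_group N)"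
    then show "assoc_act Y act (assoc_act Y act u x) y
        = assoc_act Y act (assoc_act Y act u y) (assoc_op Q opr x y)"
      unfolding carrier
      by (auto simp: assoc_op_def assoc_act_def intro!: iter_conjugate act_bij act_act)
  next
    show "group (assoc_group N l)" for l by (rule grp)
  qed (auto simp: Y_nonempty carrier assoc_op_def assoc_act_def iter_op_Q_closed
        iter_op_Y_closed assoc_group_def iter_op_cyclic[OF N] one_cyclic zero)
qed

end

lemma free_extend:
  assumes "comm_group A" and f: "f \<in> S \<rightarrow> carrier A"
  shows "free_extend A f \<in> hom (free_Abelian_group S) A"
    and "s \<in> S \<Longrightarrow> free_extend A f (frag_of s) = f s"
proof -
  interpret A: comm_group A by fact
  show "free_extend A f (frag_of s) = f s" if "s \<in> S" for s
    using that f by (auto simp: free_extend_def Pi_iff)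
  show "free_extend A f \<in> hom (free_Abelian_group S) A"
  proof (rule homI)
    have fin: "finprod A (\<lambda>s. f s [^]\<^bsub>A\<^esub> Poly_Mapping.lookup c s) T = free_extend A f c"
      if "finite T" "Poly_Mapping.keys c \<subseteq> T" "T \<subseteq> S" for c T
      unfolding free_extend_def using that f
      by (intro A.finprod_mono_neutral_cong_right) (auto simp: in_keys_iff)
    show "free_extend A f c \<in> carrier A" if "c \<in> carrier (free_Abelian_group S)" for c
      unfolding free_extend_def using that f by (intro A.finprod_closed) auto
    show "free_extend A f (c \<otimes>\<^bsub>free_Abelian_group S\<^esub> d) = free_extend A f c \<otimes>\<^bsub>A\<^esub> free_extend A f d"
      if "c \<in> carrier (free_Abelian_group S)" "d \<in> carrier (free_Abelian_group S)" for c d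
    proof -
      let ?T = "Poly_Mapping.keys c \<union> Poly_Mapping.keys d"
      have T: "finite ?T" "?T \<subseteq> S" using that by auto
      have "free_extend A f (c + d)
          = finprod A (\<lambda>s. f s [^]\<^bsub>A\<^esub> (Poly_Mapping.lookup c s + Poly_Mapping.lookup d s)) ?T"
        using fin[OF T(1) keys_add T(2)] by (simp add: lookup_add)
      also have "\<dots> = finprod A (\<lambda>s. f s [^]\<^bsub>A\<^esub> Poly_Mapping.lookup c s \<otimes>\<^bsub>A\<^esub> f s [^]\<^bsub>A\<^esub> Poly_Mapping.lookup d s) ?T"
        using T f by (intro A.finprod_cong') (auto simp: A.int_pow_mult Pi_iff subset_iff)
      also have "\<dots> = free_extend A f c \<otimes>\<^bsub>A\<^esub> free_extend A f d"
        using T f fin[OF T(1) _ T(2), of c] fin[OF T(1) _ T(2), of d]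
        by (subst A.finprod_multf) (auto simp: Pi_iff subset_iff)
      finally show ?thesis by simp
    qed
  qed
qed

end

theory Submission
  imports Defs "HOL-Algebra.Multiplicative_Group" "HOL-Library.Periodic_Fun"
begin

text \<open>
  All cochains in the theorem come from one chain-level construction on the integers. For
  \<open>i, j \<in> \<int>\<close> the symbol \<open>\<langle>\<upsilon>\<rangle>\<langle>(a, i)\<rangle>\<langle>(b, j)\<rangle>\<close> is thought of as an \<open>i \<times> j\<close> grid of crossings
  between \<open>i\<close> parallel strands coloured \<open>a\<close> and \<open>j\<close> parallel strands coloured \<open>b\<close>; it is sent to the
  sum in \<open>C\<^sub>2\<^sup>R(Q)\<^sub>Y\<close> of the symbols of these crossings (\<open>lattice_chain\<close>), with negative \<open>i\<close> or \<open>j\<close>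
  read as a summation over a reversed range. The sign cases in the definition for \<open>\<int>\<close> are
  exactly the values of \<open>\<theta>\<close> on these signed sums, and the finite cochain consists of the values
  for positive representatives.

  Cutting the grid along either side makes the lattice chain additive in \<open>i\<close> and in \<open>j\<close>, up to
  moving the base point \<open>\<upsilon>\<close> and the colours. Since the symbols \<open>\<langle>\<upsilon>\<rangle>\<langle>x\<^sub>1, x\<^sub>2\<rangle>\<close> have value \<open>0\<close>, this is
  precisely what the two cocycle conditions about a product in one factor of \<open>\<langle>\<upsilon>\<rangle>\<langle>x\<rangle>\<langle>y\<rangle>\<close> demand;
  the associativity condition becomes trivial. For the condition on three elements \<open>x, y, z\<close>, the
  difference of its two sides (\<open>defect\<close>) is again additive in each of the three exponents, so it is a
  combination of defects with all exponents \<open>1\<close>, and these are killed by \<open>\<theta>\<close> because they are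
  the rack cocycle condition (\<open>defect_null\<close>). Working with chains, where subtraction is available
  without side conditions, and applying \<open>\<theta>\<close> only at the end keeps this a computation in an abelian
  group given by a type class.

  Modulo \<open>N < \<infinity>\<close> the only further requirement is that the values depend on \<open>i\<close> and \<open>j\<close> only modulo
  \<open>N\<close> (\<open>mgr_cocycle_if_lattice_values\<close>). By additivity it suffices that \<open>\<theta>\<close> vanishes on the
  \<open>N \<times> 1\<close> and \<open>1 \<times> N\<close> grids, which is the hypothesis on the two sums. If instead \<open>k\<close> annihilates \<open>A\<close>,
  write \<open>N = k t\<close> where \<open>t\<close> is the type: running through \<open>t\<close> strands returns base point and colours
  to where they started, so the long grid consists of \<open>k\<close> equal blocks and contributes \<open>k\<close> times an
  element of \<open>A\<close>, that is, \<open>0\<close>. A finite group is annihilated by its order, by Lagrange's theorem.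
\<close>

section \<open>Signed sums over integer ranges\<close>

text \<open>
  The sum from \<open>0\<close> to \<open>i\<close> with the orientation convention of integrals, so that it is additive over
  adjacent ranges for endpoints in any order.
\<close>

definition zsum :: "(int \<Rightarrow> 'a::ab_group_add) \<Rightarrow> int \<Rightarrow> 'a" where
  "zsum f i = (\<Sum>p\<in>{0..<i}. f p) - (\<Sum>p\<in>{i..<0}. f p)"

lemma zsum_0 [simp]: "zsum f 0 = 0"
  by (simp add: zsum_def)

lemma zsum_step: "zsum f (i + 1) = zsum f i + f i"
proof (cases "0 \<le> i")
  case True
  then have "{0..<i + 1} = insert i {0..<i}" by auto
  with True show ?thesis by (simp add: zsum_def add.commute)
next
  case False
  then have "{i..<0} = insert i {i + 1..<0}" by auto
  with False show ?thesis by (simp add: zsum_def)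
qed

lemma zsum_1 [simp]: "zsum f 1 = f 0"
  using zsum_step[of f 0] by simp

lemma zsum_add: "zsum f (i + j) = zsum f i + zsum (\<lambda>p. f (i + p)) j"
proof (induction j rule: int_induct[where k = 0])
  case (step1 j)
  then show ?case
    using zsum_step[of f "i + j"] zsum_step[of "\<lambda>p. f (i + p)" j] by (simp add: add.assoc)
next
  case (step2 j)
  then show ?case
    using zsum_step[of f "i + (j - 1)"] zsum_step[of "\<lambda>p. f (i + p)" "j - 1"]
    by (simp add: algebra_simps)
qed simp

lemma zsum_distrib: "zsum (\<lambda>p. f p + g p) i = zsum f i + zsum g i"
  by (simp add: zsum_def sum.distrib)

lemma zsum_pos:
  assumes "0 \<le> i"
  shows "zsum f i = (\<Sum>p\<in>{1..i}. f (p - 1))"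
proof -
  have "(\<Sum>p\<in>{1..i}. f (p - 1)) = (\<Sum>p\<in>{0..<i}. f p)"
    by (rule sum.reindex_bij_witness[of _ "\<lambda>p. p + 1" "\<lambda>p. p - 1"]) auto
  then show ?thesis using assms by (simp add: zsum_def)
qed

text \<open>
  Induction over \<open>\<int>\<close> in both directions for statements "\<open>F i\<close> lies in the subgroup \<open>K\<close>": the downward
  step is free, because \<open>F (i - 1)\<close> is the difference of \<open>F i\<close> and an increment.
\<close>

lemma int_steps_in_subgroup:
  fixes F :: "int \<Rightarrow> 'a::ab_group_add"
  assumes diff: "\<And>x y. \<lbrakk>x \<in> K; y \<in> K\<rbrakk> \<Longrightarrow> x - y \<in> K"
    and F0: "F 0 \<in> K" and step: "\<And>i. F (i + 1) - F i \<in> K"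
  shows "F i \<in> K"
proof -
  have add: "x + y \<in> K" if "x \<in> K" "y \<in> K" for x y
    using diff[OF that(1) diff[OF diff[OF that(2) that(2)] that(2)]] by simp
  show ?thesis
  proof (induction i rule: int_induct[where k = 0])
    case (step1 i)
    then show ?case using add[OF step[of i], of "F i"] by simp
  next
    case (step2 i)
    then show ?case using diff[OF _ step, of "F i" "i - 1"] by simp
  qed (rule F0)
qed

section \<open>Lattice chains\<close>

locale shadow_rack_cocycle = rack_set Q opr Y act + A: comm_group A
  for Q :: "'q set" and opr :: "'q \<Rightarrow> 'q \<Rightarrow> 'q" and Y :: "'y set" and act :: "'y \<Rightarrow> 'q \<Rightarrow> 'y"
    and A :: "('g, 'm) monoid_scheme" +
  fixes \<theta> :: "('y \<times> 'q \<times> 'q \<Rightarrow>\<^sub>0 int) \<Rightarrow> 'g"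
  assumes cocycle: "shadow_rack_2cocycle Q opr Y act A \<theta>"
begin

abbreviation rpow :: "'q \<Rightarrow> int \<Rightarrow> 'q \<Rightarrow> 'q" where
  "rpow \<equiv> iter_op Q opr"

abbreviation ypow :: "'y \<Rightarrow> int \<Rightarrow> 'q \<Rightarrow> 'y" where
  "ypow \<equiv> iter_op Y act"

lemma pow_0 [simp]: "rpow a 0 b = a" "ypow u 0 b = u"
  by (simp_all add: iter_op_def)

lemma pow_1:
  "\<lbrakk>a \<in> Q; b \<in> Q\<rbrakk> \<Longrightarrow> rpow a 1 b = opr a b"
  "\<lbrakk>u \<in> Y; b \<in> Q\<rbrakk> \<Longrightarrow> ypow u 1 b = act u b"
  using zpow_Suc(1)[OF opr_bij, of b a 0] zpow_Suc(1)[OF act_bij, of b u 0]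
  by (simp_all add: iter_op_def)

lemma pow_add:
  "\<lbrakk>a \<in> Q; b \<in> Q\<rbrakk> \<Longrightarrow> rpow a (i + j) b = rpow (rpow a i b) j b"
  "\<lbrakk>u \<in> Y; b \<in> Q\<rbrakk> \<Longrightarrow> ypow u (i + j) b = ypow (ypow u i b) j b"
  by (simp_all add: iter_op_def zpow_add[OF opr_bij] zpow_add[OF act_bij])

text \<open>
  The two swap laws are self-distributivity of the rack \<open>Q \<times> \<int>\<close> and its compatibility with the
  action on \<open>Y\<close>; they carry all comparisons of base points and colours below.
\<close>

lemma rpow_swap:
  "\<lbrakk>a \<in> Q; b \<in> Q; c \<in> Q\<rbrakk> \<Longrightarrow> rpow (rpow a j b) k c = rpow (rpow a k c) j (rpow b k c)"
  by (rule iter_conjugate) (auto intro: opr_bij opr_distrib)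

lemma ypow_swap:
  "\<lbrakk>u \<in> Y; a \<in> Q; b \<in> Q\<rbrakk> \<Longrightarrow> ypow (ypow u i a) j b = ypow (ypow u j b) i (rpow a j b)"
  by (rule iter_conjugate) (auto intro: act_bij act_act)

lemmas pow_closed = iter_op_Q_closed iter_op_Y_closed

definition lattice_chain :: "'y \<Rightarrow> 'q \<Rightarrow> int \<Rightarrow> 'q \<Rightarrow> int \<Rightarrow> ('y \<times> 'q \<times> 'q \<Rightarrow>\<^sub>0 int)" where
  "lattice_chain u a i b j =
     zsum (\<lambda>p. zsum (\<lambda>q. frag_of (ypow (ypow u p a) q b, rpow a q b, b)) j) i"

lemma lattice_chain_0 [simp]: "lattice_chain u a 0 b j = 0" "lattice_chain u a i b 0 = 0"
  by (simp_all add: lattice_chain_def zsum_def)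

lemma lattice_chain_add_left:
  assumes "u \<in> Y" "a \<in> Q"
  shows "lattice_chain u a (i + i') b j
       = lattice_chain u a i b j + lattice_chain (ypow u i a) a i' b j"
  using assms by (simp add: lattice_chain_def zsum_add pow_add)

text \<open>
  The base point of row \<open>p\<close> beyond column \<open>j\<close> is reached by acting with \<open>a\<close> first and \<open>b\<close> second. The
  swap law turns this into acting with \<open>b\<close> first, which replaces \<open>a\<close> by its translate: hence both
  arguments \<open>u\<close> and \<open>a\<close> change in the second summand.
\<close>

lemma lattice_chain_add_right:
  assumes "u \<in> Y" "a \<in> Q" "b \<in> Q"
  shows "lattice_chain u a i b (j + j')
       = lattice_chain u a i b j + lattice_chain (ypow u j b) (rpow a j b) i b j'"
  using assms
  by (simp add: lattice_chain_def zsum_add zsum_distrib pow_add pow_closed ypow_swap[of u a b _ j])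

lemma lattice_chain_1_1: "lattice_chain u a 1 b 1 = frag_of (u, a, b)"
  by (simp add: lattice_chain_def)

section \<open>The defect of the rack cocycle condition\<close>

text \<open>The failure of the cocycle condition on the three elements \<open>(a, i)\<close>, \<open>(b, j)\<close>, \<open>(c, k)\<close>.\<close>

definition defect ::
  "'y \<Rightarrow> 'q \<Rightarrow> int \<Rightarrow> 'q \<Rightarrow> int \<Rightarrow> 'q \<Rightarrow> int \<Rightarrow> ('y \<times> 'q \<times> 'q \<Rightarrow>\<^sub>0 int)" where
  "defect u a i b j c k =
     (lattice_chain (ypow u i a) b j c k + lattice_chain u a i c k
        + lattice_chain (ypow u k c) (rpow a k c) i (rpow b k c) j)
     - (lattice_chain u b j c k + lattice_chain (ypow u j b) (rpow a j b) i c k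
        + lattice_chain u a i b j)"

text \<open>
  Each term of the defect whose grid has the split exponent as a side falls into two pieces by
  additivity of the lattice chain. The other two terms have opposite signs and differ by a translation
  along the split strands, so they telescope; the swap laws identify the remaining base points and
  colours.
\<close>

context
  fixes u a b c
  assumes mem: "u \<in> Y" "a \<in> Q" "b \<in> Q" "c \<in> Q"
begin

lemma defect_add_first:
  "defect u a (i + i') b j c k = defect u a i b j c k + defect (ypow u i a) a i' b j c k"
  using mem by (simp add: defect_def lattice_chain_add_left pow_add pow_closed
      ypow_swap[of u a b i j] ypow_swap[of u a c i k])

lemma defect_add_second:
  "defect u a i b (j + j') c k
   = defect u a i b j c k + defect (ypow u j b) (rpow a j b) i b j' c k"
  using mem by (simp add: defect_def lattice_chain_add_left lattice_chain_add_right pow_add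
      pow_closed ypow_swap[of u a b i j] ypow_swap[of u b c j k] rpow_swap[of a b c j k])

lemma defect_add_third:
  "defect u a i b j c (k + k')
   = defect u a i b j c k + defect (ypow u k c) (rpow a k c) i (rpow b k c) j c k'"
  using mem by (simp add: defect_def lattice_chain_add_right pow_add
      pow_closed ypow_swap[of u a c i k] ypow_swap[of u b c j k] rpow_swap[of a b c j k])

end

section \<open>Chains annihilated by the cocycle\<close>

abbreviation chains :: "('y \<times> 'q \<times> 'q \<Rightarrow>\<^sub>0 int) monoid" where
  "chains \<equiv> free_Abelian_group (Y \<times> Q \<times> Q)"

lemma \<theta>_hom: "\<theta> \<in> hom chains A"
  using cocycle by (simp add: shadow_rack_2cocycle_def)

sublocale \<theta>: group_hom chains A \<theta>
  by (intro group_hom.intro group_hom_axioms.intro group_free_Abelian_group A.is_group \<theta>_hom)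

lemma chains_closed:
  assumes "x \<in> carrier chains" "y \<in> carrier chains"
  shows "x + y \<in> carrier chains" "- x \<in> carrier chains" "x - y \<in> carrier chains"
  using assms keys_add[of x y] keys_diff[of x y] by auto

lemma chains_0: "0 \<in> carrier chains"
  by simp

text \<open>
  From here on, membership in the chain group is handled through its closure properties; unfolding it
  into a condition on supports would defeat them.
\<close>

declare carrier_free_Abelian_group_iff [simp del]

lemma \<theta>_add:
  "\<lbrakk>x \<in> carrier chains; y \<in> carrier chains\<rbrakk> \<Longrightarrow> \<theta> (x + y) = \<theta> x \<otimes>\<^bsub>A\<^esub> \<theta> y"
  using \<theta>.hom_mult[of x y] by simp

lemma \<theta>_minus: "x \<in> carrier chains \<Longrightarrow> \<theta> (- x) = inv\<^bsub>A\<^esub> \<theta> x"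
  using \<theta>.hom_inv[of x] by (simp add: carrier_free_Abelian_group_iff)

lemma \<theta>_diff:
  "\<lbrakk>x \<in> carrier chains; y \<in> carrier chains\<rbrakk> \<Longrightarrow> \<theta> (x - y) = \<theta> x \<otimes>\<^bsub>A\<^esub> inv\<^bsub>A\<^esub> \<theta> y"
  using \<theta>_add[of x "- y"] by (simp add: \<theta>_minus chains_closed)

lemma \<theta>_sum:
  assumes "finite I" "\<And>p. p \<in> I \<Longrightarrow> f p \<in> carrier chains"
  shows "\<theta> (\<Sum>p\<in>I. f p) = (\<Otimes>\<^bsub>A\<^esub>p\<in>I. \<theta> (f p))"
  using assms
proof (induction I rule: finite_induct)
  case empty
  then show ?case using \<theta>.hom_one by simp
next
  case (insert p I)
  have "sum f I \<in> carrier chains"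
    using insert.prems by (intro sum_closed_free_Abelian_group) auto
  then have "\<theta> (sum f (insert p I)) = \<theta> (f p) \<otimes>\<^bsub>A\<^esub> \<theta> (sum f I)"
    using insert by (simp add: \<theta>_add)
  moreover have "(\<Otimes>\<^bsub>A\<^esub>q\<in>insert p I. \<theta> (f q)) = \<theta> (f p) \<otimes>\<^bsub>A\<^esub> (\<Otimes>\<^bsub>A\<^esub>q\<in>I. \<theta> (f q))"
    using insert by (intro A.finprod_insert) auto
  ultimately show ?case using insert by simp
qed

lemma lattice_chain_in_chains:
  assumes "u \<in> Y" "a \<in> Q" "b \<in> Q"
  shows "lattice_chain u a i b j \<in> carrier chains"
proof -
  have zsum_closed: "zsum f m \<in> carrier chains" if "\<And>p. f p \<in> carrier chains" for f m
    by (rule int_steps_in_subgroup[OF chains_closed(3)]) (use that in \<open>simp_all add: zsum_step chains_0\<close>)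
  show ?thesis
    unfolding lattice_chain_def using assms by (intro zsum_closed) (simp add: pow_closed)
qed

abbreviation null_chains :: "('y \<times> 'q \<times> 'q \<Rightarrow>\<^sub>0 int) set" where
  "null_chains \<equiv> kernel chains A \<theta>"

lemma null_diff: "\<lbrakk>x \<in> null_chains; y \<in> null_chains\<rbrakk> \<Longrightarrow> x - y \<in> null_chains"
  by (simp add: kernel_def \<theta>_diff chains_closed)

lemma null_0: "0 \<in> null_chains"
  using \<theta>.hom_one by (simp add: kernel_def chains_0)

lemma \<theta>_eqI:
  assumes "x - y \<in> null_chains" "y \<in> carrier chains"
  shows "\<theta> x = \<theta> y"
proof -
  have "\<theta> (x - y + y) = \<theta> (x - y) \<otimes>\<^bsub>A\<^esub> \<theta> y"
    using assms by (intro \<theta>_add) (simp_all add: kernel_def)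
  then show ?thesis using assms by (simp add: kernel_def)
qed

text \<open>With all exponents equal to \<open>1\<close> the defect is literally the rack cocycle relation.\<close>

lemma unit_defect_null:
  assumes "u \<in> Y" "a \<in> Q" "b \<in> Q" "c \<in> Q"
  shows "defect u a 1 b 1 c 1 \<in> null_chains"
proof -
  let ?x = "frag_of (act u a, b, c) + frag_of (u, a, c) + frag_of (act u c, opr a c, opr b c)"
  let ?y = "frag_of (u, b, c) + frag_of (act u b, opr a b, c) + frag_of (u, a, b)"
  have closed: "act v d \<in> Y" "opr e d \<in> Q" if "v \<in> Y" "d \<in> Q" "e \<in> Q" for v d e
    using act_bij[OF that(2)] opr_bij[OF that(2)] that by (auto dest: bij_betwE)
  have xy: "?x \<in> carrier chains" "?y \<in> carrier chains"
    using assms closed by (simp_all add: chains_closed)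
  moreover have "\<theta> ?x = \<theta> ?y"
    using cocycle assms unfolding shadow_rack_2cocycle_def by blast
  ultimately have "?x - ?y \<in> null_chains"
    using \<theta>.hom_closed[OF xy(2)] by (simp add: kernel_def \<theta>_diff chains_closed(3))
  then show ?thesis using assms by (simp add: defect_def lattice_chain_1_1 pow_1)
qed

text \<open>
  Three integer inductions, one per exponent, reduce to unit exponents. At each stage the earlier
  statement is needed for all base points and colours, because an induction step moves them.
\<close>

lemma defect_null:
  assumes "u \<in> Y" "a \<in> Q" "b \<in> Q" "c \<in> Q"
  shows "defect u a i b j c k \<in> null_chains"
proof -
  \<comment> \<open>Additivity at \<open>0 + 0\<close> reads \<open>d = d + d\<close>, since acting with exponent \<open>0\<close> moves nothing.\<close>
  have zero:
    "defect u a 0 b j c k = 0" "defect u a i b 0 c k = 0" "defect u a i b j c 0 = 0"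
    if "u \<in> Y" "a \<in> Q" "b \<in> Q" "c \<in> Q" for u a i b j c k
    using defect_add_first[OF that, of 0 0 j k] defect_add_second[OF that, of i 0 0 k]
      defect_add_third[OF that, of i j 0 0] by simp_all
  have 1: "defect u a i b 1 c 1 \<in> null_chains"
    if "u \<in> Y" "a \<in> Q" "b \<in> Q" "c \<in> Q" for u a b c i
    by (rule int_steps_in_subgroup[OF null_diff])
      (use that in \<open>simp_all add: zero null_0 defect_add_first unit_defect_null pow_closed\<close>)
  have 2: "defect u a i b j c 1 \<in> null_chains"
    if "u \<in> Y" "a \<in> Q" "b \<in> Q" "c \<in> Q" for u a b c i j
    by (rule int_steps_in_subgroup[OF null_diff])
      (use that in \<open>simp_all add: zero null_0 defect_add_second 1 pow_closed\<close>)
  show ?thesis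
    by (rule int_steps_in_subgroup[OF null_diff])
      (use assms in \<open>simp_all add: zero null_0 defect_add_third 2 pow_closed\<close>)
qed

section \<open>Values of the cocycle on lattice chains\<close>

lemma \<theta>_lattice_chain:
  assumes "u \<in> Y" "a \<in> Q" "b \<in> Q" "0 \<le> i" "0 \<le> j"
  shows "\<theta> (lattice_chain u a i b j) = theta_sum Q opr Y act A \<theta> u a i b j"
proof -
  let ?s = "\<lambda>p q. frag_of (ypow (ypow u (p - 1) a) (q - 1) b, rpow a (q - 1) b, b)"
  have frag: "?s p q \<in> carrier chains" for p q
    using assms by (simp add: pow_closed)
  have "\<theta> (lattice_chain u a i b j) = \<theta> (\<Sum>p\<in>{1..i}. \<Sum>q\<in>{1..j}. ?s p q)"
    using assms by (simp add: lattice_chain_def zsum_pos)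
  also have "\<dots> = (\<Otimes>\<^bsub>A\<^esub>p\<in>{1..i}. \<theta> (\<Sum>q\<in>{1..j}. ?s p q))"
    using frag by (intro \<theta>_sum sum_closed_free_Abelian_group) auto
  also have "\<dots> = theta_sum Q opr Y act A \<theta> u a i b j"
    using assms \<theta>_sum[OF _ frag, of "{1..j}" _ "\<lambda>q. q"] by (simp add: theta_sum_def)
  finally show ?thesis .
qed

text \<open>
  The next two lemmas explain the base points and colours in the sign cases for \<open>\<int>\<close>: a reversed range is the
  negative of the forward range that starts where the reversed one ends.
\<close>

lemma lattice_chain_uminus_left:
  assumes "u \<in> Y" "a \<in> Q"
  shows "lattice_chain u a (- i) b j = - lattice_chain (ypow u (- i) a) a i b j"
  using lattice_chain_add_left[OF assms, of "- i" i b j]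
  by (simp add: eq_neg_iff_add_eq_0)

lemma lattice_chain_uminus_right:
  assumes "u \<in> Y" "a \<in> Q" "b \<in> Q"
  shows "lattice_chain u a i b (- j) = - lattice_chain (ypow u (- j) b) (rpow a (- j) b) i b j"
  using lattice_chain_add_right[OF assms, of i "- j" j] by (simp add: eq_neg_iff_add_eq_0)

section \<open>The cocycle criterion on the associated multiple group rack\<close>

text \<open>
  This covers \<open>\<int>\<close> and \<open>\<int>\<^sub>n\<close> at once. The condition on three elements involves no addition of
  exponents, so it follows from \<open>defect_null\<close> for any representatives; exponents are added only in the
  conditions about products, and there the two periodicity hypotheses let the sum in \<open>\<int>\<close> stand for the
  one in \<open>\<int>\<^sub>N\<close>.
\<close>

lemma mgr_cocycle_if_lattice_values:
  assumes cross: "\<And>u a i b j. \<lbrakk>u \<in> Y; a \<in> Q; b \<in> Q; i \<in> carrier (cyclic N); j \<in> carrier (cyclic N)\<rbrakk>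
      \<Longrightarrow> f (Cross u (a, i) (b, j)) = \<theta> (lattice_chain u a i b j)"
    and join: "\<And>u x y. f (Join u x y) = \<one>\<^bsub>A\<^esub>"
    and left: "\<And>u a i i' b j. \<lbrakk>u \<in> Y; a \<in> Q; b \<in> Q\<rbrakk>
      \<Longrightarrow> \<theta> (lattice_chain u a (i \<otimes>\<^bsub>cyclic N\<^esub> i') b j) = \<theta> (lattice_chain u a (i + i') b j)"
    and right: "\<And>u a i b j j'. \<lbrakk>u \<in> Y; a \<in> Q; b \<in> Q\<rbrakk>
      \<Longrightarrow> \<theta> (lattice_chain u a i b (j \<otimes>\<^bsub>cyclic N\<^esub> j')) = \<theta> (lattice_chain u a i b (j + j'))"
  shows "shadow_mgr_2cocycle Q (assoc_group N) (assoc_op Q opr) Y (assoc_act Y act) A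
    (free_extend A f)"
proof -
  interpret Z: group "cyclic N" by (rule group_cyclic)
  have carrier: "mgr_carrier Q (assoc_group N) = Q \<times> carrier (cyclic N)"
    by (auto simp: mgr_carrier_def assoc_group_def)
  have group_carrier: "carrier (assoc_group N l) = {l} \<times> carrier (cyclic N)" for l
    by (simp add: assoc_group_def)
  have mult: "(l, i) \<otimes>\<^bsub>assoc_group N l'\<^esub> (l, j) = (l', i \<otimes>\<^bsub>cyclic N\<^esub> j)" for l l' i j
    by (simp add: assoc_group_def)
  let ?S = "mgr_syms Q (assoc_group N) Y"
  have cross_in: "Cross u (a, i) (b, j) \<in> ?S"
    if "u \<in> Y" "a \<in> Q" "b \<in> Q" "i \<in> carrier (cyclic N)" "j \<in> carrier (cyclic N)" for u a i b j
    using that by (simp add: mgr_syms_def carrier)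
  have join_in: "Join u (a, i) (a, j) \<in> ?S"
    if "u \<in> Y" "a \<in> Q" "i \<in> carrier (cyclic N)" "j \<in> carrier (cyclic N)" for u a i j
    using that by (auto simp: mgr_syms_def group_carrier)
  have closed: "\<theta> (lattice_chain u a i b j) \<in> carrier A"
    if "u \<in> Y" "a \<in> Q" "b \<in> Q" for u a i b j
    using that by (intro \<theta>.hom_closed lattice_chain_in_chains)
  have f: "f \<in> ?S \<rightarrow> carrier A"
    by (auto simp: mgr_syms_def carrier cross join closed)
  let ?F = "free_extend A f"
  note hom = free_extend(1)[OF A.comm_group_axioms f]
  note gen = free_extend(2)[OF A.comm_group_axioms f]
  have two: "?F (frag_of s + frag_of t) = f s \<otimes>\<^bsub>A\<^esub> f t" if "s \<in> ?S" "t \<in> ?S" for s t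
    using hom_mult[OF hom, of "frag_of s" "frag_of t"] that by (simp add: gen)
  have three: "?F (frag_of r + frag_of s + frag_of t) = f r \<otimes>\<^bsub>A\<^esub> f s \<otimes>\<^bsub>A\<^esub> f t"
    if "r \<in> ?S" "s \<in> ?S" "t \<in> ?S" for r s t
  proof -
    have "Poly_Mapping.keys (frag_of r + frag_of s) \<subseteq> ?S"
      using that by (intro order_trans[OF keys_add]) auto
    then show ?thesis
      using hom_mult[OF hom, of "frag_of r + frag_of s" "frag_of t"] that by (simp add: gen two
          carrier_free_Abelian_group_iff)
  qed
  have rack_terms: "?F (cross (assoc_act Y act u x) y z + cross u x z
        + cross (assoc_act Y act u z) (assoc_op Q opr x z) (assoc_op Q opr y z))
      = ?F (cross u y z + cross (assoc_act Y act u y) (assoc_op Q opr x y) z + cross u x y)"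
    if "u \<in> Y" and xyz_in: "x \<in> mgr_carrier Q (assoc_group N)" "y \<in> mgr_carrier Q (assoc_group N)"
      "z \<in> mgr_carrier Q (assoc_group N)" for u x y z
  proof -
    obtain a i b j c k where xyz: "x = (a, i)" "y = (b, j)" "z = (c, k)"
      and mem: "a \<in> Q" "b \<in> Q" "c \<in> Q" "i \<in> carrier (cyclic N)" "j \<in> carrier (cyclic N)"
        "k \<in> carrier (cyclic N)"
      using xyz_in by (auto simp: carrier)
    note [simp] = \<open>u \<in> Y\<close> mem pow_closed
    let ?L = lattice_chain
    note add = \<theta>_add chains_closed lattice_chain_in_chains
    have "\<theta> (?L (ypow u i a) b j c k + ?L u a i c k + ?L (ypow u k c) (rpow a k c) i (rpow b k c) j)
        = \<theta> (?L u b j c k + ?L (ypow u j b) (rpow a j b) i c k + ?L u a i b j)"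
      using defect_null[of u a b c i j k]
      by (intro \<theta>_eqI) (simp_all add: defect_def add)
    then show ?thesis
      by (simp add: xyz assoc_act_def assoc_op_def three cross_in cross add)
  qed
  have right_terms: "?F (join (assoc_act Y act u x) y1 y2 + cross u x (y1 \<otimes>\<^bsub>assoc_group N l\<^esub> y2))
      = ?F (join u y1 y2 + cross (assoc_act Y act u y1) (assoc_op Q opr x y1) y2 + cross u x y1)"
    if "u \<in> Y" and xy_in: "x \<in> mgr_carrier Q (assoc_group N)" "l \<in> Q"
      "y1 \<in> carrier (assoc_group N l)" "y2 \<in> carrier (assoc_group N l)" for u x l y1 y2
  proof -
    obtain a i j j' where xy: "x = (a, i)" "y1 = (l, j)" "y2 = (l, j')"
      and mem: "a \<in> Q" "i \<in> carrier (cyclic N)" "j \<in> carrier (cyclic N)" "j' \<in> carrier (cyclic N)"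
      using xy_in by (auto simp: carrier group_carrier)
    note [simp] = \<open>u \<in> Y\<close> \<open>l \<in> Q\<close> mem pow_closed closed
    show ?thesis
      by (simp add: xy mult assoc_act_def assoc_op_def two three cross_in join_in cross join right
          lattice_chain_add_right \<theta>_add lattice_chain_in_chains A.m_comm)
  qed
  have left_terms: "?F (cross (assoc_act Y act u x1) x2 y + cross u x1 y
        + join (assoc_act Y act u y) (assoc_op Q opr x1 y) (assoc_op Q opr x2 y))
      = ?F (cross u (x1 \<otimes>\<^bsub>assoc_group N l\<^esub> x2) y + join u x1 x2)"
    if "u \<in> Y" and xy_in: "l \<in> Q" "x1 \<in> carrier (assoc_group N l)" "x2 \<in> carrier (assoc_group N l)"
      "y \<in> mgr_carrier Q (assoc_group N)" for u l x1 x2 y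
  proof -
    obtain i i' b j where xy: "x1 = (l, i)" "x2 = (l, i')" "y = (b, j)"
      and mem: "b \<in> Q" "i \<in> carrier (cyclic N)" "i' \<in> carrier (cyclic N)" "j \<in> carrier (cyclic N)"
      using xy_in by (auto simp: carrier group_carrier)
    note [simp] = \<open>u \<in> Y\<close> \<open>l \<in> Q\<close> mem pow_closed closed
    show ?thesis
      by (simp add: xy mult assoc_act_def assoc_op_def two three cross_in join_in cross join left
          lattice_chain_add_left \<theta>_add lattice_chain_in_chains A.m_comm)
  qed
  have join_terms: "?F (join (assoc_act Y act u x1) x2 x3 + join u x1 (x2 \<otimes>\<^bsub>assoc_group N l\<^esub> x3))
      = ?F (join u (x1 \<otimes>\<^bsub>assoc_group N l\<^esub> x2) x3 + join u x1 x2)"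
    if "u \<in> Y" "l \<in> Q" "x1 \<in> carrier (assoc_group N l)" "x2 \<in> carrier (assoc_group N l)"
      "x3 \<in> carrier (assoc_group N l)" for u l x1 x2 x3
    using that
    by (auto simp: group_carrier mult assoc_act_def two join_in join pow_closed)
  show ?thesis
    unfolding shadow_mgr_2cocycle_def
    using hom rack_terms right_terms left_terms join_terms by blast
qed

section \<open>The infinite and the finite cochain\<close>

text \<open>
  Over \<open>\<int>\<close> periodicity is void, so only the sign cases have to be recognised as values on lattice
  chains.
\<close>

lemma theta_infinite_cocycle:
  "shadow_mgr_2cocycle Q (assoc_group \<infinity>) (assoc_op Q opr) Y (assoc_act Y act) A
    (theta_infinite Q opr Y act A \<theta>)"
  unfolding theta_infinite_def
proof (rule mgr_cocycle_if_lattice_values, goal_cases)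
  case (1 u a i b j)
  have neg_left: "\<theta> (lattice_chain v c m b n) = inv\<^bsub>A\<^esub> \<theta> (lattice_chain (ypow v m c) c (- m) b n)"
    if "v \<in> Y" "c \<in> Q" for v c m n
    using that 1 lattice_chain_uminus_left[of v c "- m" b n]
    by (simp add: \<theta>_minus lattice_chain_in_chains pow_closed)
  have neg_right: "\<theta> (lattice_chain v c m b n)
      = inv\<^bsub>A\<^esub> \<theta> (lattice_chain (ypow v n b) (rpow c n b) m b (- n))"
    if "v \<in> Y" "c \<in> Q" for v c m n
    using that 1 lattice_chain_uminus_right[of v c b m "- n"]
    by (simp add: \<theta>_minus lattice_chain_in_chains pow_closed)
  consider "i > 0" "j > 0" | "i > 0" "j < 0" | "i < 0" "j > 0" | "i < 0" "j < 0" | "i = 0" | "j = 0"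
    by linarith
  then show ?case
  proof cases
    case 4
    \<comment> \<open>Both ranges are reversed, and the two signs cancel.\<close>
    have "\<theta> (lattice_chain u a i b j)
        = \<theta> (lattice_chain (ypow (ypow u i a) j b) (rpow a j b) (- i) b (- j))"
      using 1 neg_left[of u a i j] neg_right[of "ypow u i a" a "- i" j]
      by (simp add: pow_closed lattice_chain_in_chains \<theta>.hom_closed)
    with 4 1 show ?thesis by (simp add: \<theta>_lattice_chain pow_closed)
  qed (use 1 \<theta>.hom_one neg_left[of u a i j] neg_right[of u a i j] in
      \<open>simp_all add: \<theta>_lattice_chain pow_closed\<close>)
qed (simp_all add: cyclic_def)

text \<open>
  Grids with one full period along one side and width \<open>1\<close> along the other suffice, because grids of
  arbitrary width are cut into such strips.
\<close>

lemma theta_finite_cocycle: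
  assumes "0 < n"
    and first: "\<And>u a b. \<lbrakk>u \<in> Y; a \<in> Q; b \<in> Q\<rbrakk> \<Longrightarrow> lattice_chain u a (int n) b 1 \<in> null_chains"
    and second: "\<And>u a b. \<lbrakk>u \<in> Y; a \<in> Q; b \<in> Q\<rbrakk> \<Longrightarrow> lattice_chain u a 1 b (int n) \<in> null_chains"
  shows "shadow_mgr_2cocycle Q (assoc_group (enat n)) (assoc_op Q opr) Y (assoc_act Y act) A
    (theta_finite n Q opr Y act A \<theta>)"
proof -
  have first': "lattice_chain u a (int n) b j \<in> null_chains"
    if "u \<in> Y" "a \<in> Q" "b \<in> Q" for u a b j
    by (rule int_steps_in_subgroup[OF null_diff])
      (use that in \<open>simp_all add: null_0 lattice_chain_add_right first pow_closed\<close>)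
  have second': "lattice_chain u a i b (int n) \<in> null_chains"
    if "u \<in> Y" "a \<in> Q" "b \<in> Q" for u a b i
    by (rule int_steps_in_subgroup[OF null_diff])
      (use that in \<open>simp_all add: null_0 lattice_chain_add_left second pow_closed\<close>)
  have left: "\<theta> (lattice_chain u a (i mod int n) b j) = \<theta> (lattice_chain u a i b j)"
    if [simp]: "u \<in> Y" "a \<in> Q" "b \<in> Q" for u a i b j
  proof -
    interpret periodic_fun_simple "\<lambda>i. \<theta> (lattice_chain u a i b j)" "int n"
      by unfold_locales
        (rule \<theta>_eqI, simp_all add: lattice_chain_add_left first' lattice_chain_in_chains pow_closed)
    show ?thesis
      using plus_of_int[of "i mod int n" "i div int n"] by (simp add: mult.commute)
  qed
  have right: "\<theta> (lattice_chain u a i b (j mod int n)) = \<theta> (lattice_chain u a i b j)"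
    if [simp]: "u \<in> Y" "a \<in> Q" "b \<in> Q" for u a i b j
  proof -
    interpret periodic_fun_simple "\<lambda>j. \<theta> (lattice_chain u a i b j)" "int n"
      by unfold_locales
        (rule \<theta>_eqI, simp_all add: lattice_chain_add_right second' lattice_chain_in_chains pow_closed)
    show ?thesis
      using plus_of_int[of "j mod int n" "j div int n"] by (simp add: mult.commute)
  qed
  \<comment> \<open>The representatives \<open>1, \<dots>, n\<close> make every range nonnegative, and periodicity absorbs the
    discrepancy between the residue \<open>0\<close> and its representative \<open>n\<close>.\<close>
  have rep: "pos_rep n i mod int n = i" "0 \<le> pos_rep n i" if "i \<in> carrier (cyclic (enat n))" for i
    using that \<open>0 < n\<close> by (auto simp: cyclic_def carrier_integer_mod_group pos_rep_def)
  show ?thesis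
    unfolding theta_finite_def
  proof (rule mgr_cocycle_if_lattice_values, goal_cases)
    case (1 u a i b j)
    then have "\<theta> (lattice_chain u a i b j) = \<theta> (lattice_chain u a (pos_rep n i) b (pos_rep n j))"
      using left[of u a b "pos_rep n i" j] right[of u a b "pos_rep n i" "pos_rep n j"]
      by (simp add: rep)
    with 1 show ?case by (simp add: \<theta>_lattice_chain rep)
  qed (simp_all add: cyclic_def left right)
qed

text \<open>
  Cutting a grid after \<open>t\<close> strands, where \<open>t\<close> is a common period of all translations, leaves the base
  point and the colours in place, so consecutive blocks of length \<open>t\<close> are equal.
\<close>

lemma lattice_chain_multiple_period:
  assumes period: "\<And>a b. \<lbrakk>a \<in> Q; b \<in> Q\<rbrakk> \<Longrightarrow> rpow a t b = a"
      "\<And>u b. \<lbrakk>u \<in> Y; b \<in> Q\<rbrakk> \<Longrightarrow> ypow u t b = u"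
    and mem: "u \<in> Y" "a \<in> Q" "b \<in> Q"
  shows "\<theta> (lattice_chain u a (int m * t) b j) = \<theta> (lattice_chain u a t b j) [^]\<^bsub>A\<^esub> m"
    and "\<theta> (lattice_chain u a i b (int m * t)) = \<theta> (lattice_chain u a i b t) [^]\<^bsub>A\<^esub> m"
proof -
  have closed: "lattice_chain u a i b j \<in> carrier chains" for i j
    by (rule lattice_chain_in_chains[OF mem])
  show "\<theta> (lattice_chain u a (int m * t) b j) = \<theta> (lattice_chain u a t b j) [^]\<^bsub>A\<^esub> m"
  proof (induction m)
    case (Suc m)
    have "lattice_chain u a (int (Suc m) * t) b j
        = lattice_chain u a t b j + lattice_chain u a (int m * t) b j"
      using mem lattice_chain_add_left[of u a t "int m * t" b j] by (simp add: period algebra_simps)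
    with Suc show ?case by (simp add: \<theta>_add closed A.m_comm)
  qed (use \<theta>.hom_one in simp)
  show "\<theta> (lattice_chain u a i b (int m * t)) = \<theta> (lattice_chain u a i b t) [^]\<^bsub>A\<^esub> m"
  proof (induction m)
    case (Suc m)
    have "lattice_chain u a i b (int (Suc m) * t)
        = lattice_chain u a i b t + lattice_chain u a i b (int m * t)"
      using mem lattice_chain_add_right[of u a b i t "int m * t"] by (simp add: period algebra_simps)
    with Suc show ?case by (simp add: \<theta>_add closed A.m_comm)
  qed (use \<theta>.hom_one in simp)
qed

lemma theta_finite_cocycle_if_sums_vanish:
  assumes "0 < n"
    and vanish: "\<forall>u\<in>Y. \<forall>a\<in>Q. \<forall>b\<in>Q.
      (\<Otimes>\<^bsub>A\<^esub>p\<in>{1..int n}. \<theta> (frag_of (ypow u (p - 1) a, a, b))) = \<one>\<^bsub>A\<^esub> \<and>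
      (\<Otimes>\<^bsub>A\<^esub>q\<in>{1..int n}. \<theta> (frag_of (ypow u (q - 1) b, rpow a (q - 1) b, b))) = \<one>\<^bsub>A\<^esub>"
  shows "shadow_mgr_2cocycle Q (assoc_group (enat n)) (assoc_op Q opr) Y (assoc_act Y act) A
    (theta_finite n Q opr Y act A \<theta>)"
proof (rule theta_finite_cocycle[OF \<open>0 < n\<close>])
  fix u a b assume mem: "u \<in> Y" "a \<in> Q" "b \<in> Q"
  have "\<theta> (frag_of (v, c, b)) \<in> carrier A" if "v \<in> Y" "c \<in> Q" for v c
    using that mem by (intro \<theta>.hom_closed) simp
  then have "\<theta> (lattice_chain u a (int n) b 1) = \<one>\<^bsub>A\<^esub>" "\<theta> (lattice_chain u a 1 b (int n)) = \<one>\<^bsub>A\<^esub>"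
    using mem vanish by (simp_all add: \<theta>_lattice_chain theta_sum_def pow_closed)
  then show "lattice_chain u a (int n) b 1 \<in> null_chains" "lattice_chain u a 1 b (int n) \<in> null_chains"
    using lattice_chain_in_chains[OF mem] by (simp_all add: kernel_def)
qed

lemma theta_finite_cocycle_if_exponent:
  assumes N: "enat n = k * rack_type Q opr Y act" "0 < k"
    and exponent: "\<And>\<alpha>. \<alpha> \<in> carrier A \<Longrightarrow> \<alpha> [^]\<^bsub>A\<^esub> the_enat k = \<one>\<^bsub>A\<^esub>"
  shows "shadow_mgr_2cocycle Q (assoc_group (enat n)) (assoc_op Q opr) Y (assoc_act Y act) A
    (theta_finite n Q opr Y act A \<theta>)"
proof -
  have "0 < n" by (rule rack_type_period(1)[OF N])
  \<comment> \<open>Since \<open>n\<close> is finite and positive, so are \<open>k\<close> and the type; the type is itself a period, as one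
    sees by taking the factor \<open>1\<close> in place of \<open>k\<close>.\<close>
  obtain m t where k: "k = enat m" and t: "enat t = 1 * rack_type Q opr Y act" and n: "n = m * t"
    using N \<open>0 < n\<close>
    by (cases k; cases "rack_type Q opr Y act") (auto simp: zero_enat_def split: if_splits)
  note period = rack_type_period(2,3)[OF t]
  show ?thesis
  proof (rule theta_finite_cocycle[OF \<open>0 < n\<close>])
    fix u a b assume mem: "u \<in> Y" "a \<in> Q" "b \<in> Q"
    show "lattice_chain u a (int n) b 1 \<in> null_chains" "lattice_chain u a 1 b (int n) \<in> null_chains"
      using lattice_chain_in_chains[OF mem] lattice_chain_multiple_period(1)[of "int t" u a b m 1]
        lattice_chain_multiple_period(2)[of "int t" u a b 1 m] mem
        exponent \<theta>.hom_closed
      by (simp_all add: kernel_def period n k)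
  qed
qed

end

theorem proposition6p2:
  fixes Q :: "'q set" and opr :: "'q \<Rightarrow> 'q \<Rightarrow> 'q"
    and Y :: "'y set" and act :: "'y \<Rightarrow> 'q \<Rightarrow> 'y"
    and A :: "('g, 'm) monoid_scheme" and k N :: enat
    and \<theta> :: "('y \<times> 'q \<times> 'q \<Rightarrow>\<^sub>0 int) \<Rightarrow> 'g"
  assumes "rack_set Q opr Y act" and "comm_group A" and "0 < k"
    and "shadow_rack_2cocycle Q opr Y act A \<theta>"
    and "N = k * rack_type Q opr Y act"
  shows
    "(N = \<infinity> \<longrightarrow>
        shadow_mgr_2cocycle Q (assoc_group N) (assoc_op Q opr) Y (assoc_act Y act) A
          (theta_infinite Q opr Y act A \<theta>)) \<and>
     (\<forall>n. N = enat n \<longrightarrow>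
        ((\<forall>u\<in>Y. \<forall>a\<in>Q. \<forall>b\<in>Q.
            (\<Otimes>\<^bsub>A\<^esub>p\<in>{1..int n}. \<theta> (frag_of (iter_op Y act u (p - 1) a, a, b))) = \<one>\<^bsub>A\<^esub> \<and>
            (\<Otimes>\<^bsub>A\<^esub>q\<in>{1..int n}.
               \<theta> (frag_of (iter_op Y act u (q - 1) b, iter_op Q opr a (q - 1) b, b))) = \<one>\<^bsub>A\<^esub>) \<longrightarrow>
          shadow_mgr_2cocycle Q (assoc_group N) (assoc_op Q opr) Y (assoc_act Y act) A
            (theta_finite n Q opr Y act A \<theta>)) \<and>
        ((\<forall>\<alpha>\<in>carrier A. \<alpha> [^]\<^bsub>A\<^esub> the_enat k = \<one>\<^bsub>A\<^esub>) \<longrightarrow>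
          shadow_mgr_2cocycle Q (assoc_group N) (assoc_op Q opr) Y (assoc_act Y act) A
            (theta_finite n Q opr Y act A \<theta>)) \<and>
        (finite (carrier A) \<and> k = enat (order A) \<longrightarrow>
          shadow_mgr_2cocycle Q (assoc_group N) (assoc_op Q opr) Y (assoc_act Y act) A
            (theta_finite n Q opr Y act A \<theta>)))"
proof -
  interpret shadow_rack_cocycle Q opr Y act A \<theta>
    using assms by (simp add: shadow_rack_cocycle_def shadow_rack_cocycle_axioms_def)
  show ?thesis
  proof (intro conjI impI allI)
    assume "N = \<infinity>"
    then show "shadow_mgr_2cocycle Q (assoc_group N) (assoc_op Q opr) Y (assoc_act Y act) A
        (theta_infinite Q opr Y act A \<theta>)"
      using theta_infinite_cocycle by simp
  next
    fix n
    assume N: "N = enat n" and "\<forall>u\<in>Y. \<forall>a\<in>Q. \<forall>b\<in>Q.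
      (\<Otimes>\<^bsub>A\<^esub>p\<in>{1..int n}. \<theta> (frag_of (ypow u (p - 1) a, a, b))) = \<one>\<^bsub>A\<^esub> \<and>
      (\<Otimes>\<^bsub>A\<^esub>q\<in>{1..int n}. \<theta> (frag_of (ypow u (q - 1) b, rpow a (q - 1) b, b))) = \<one>\<^bsub>A\<^esub>"
    then show "shadow_mgr_2cocycle Q (assoc_group N) (assoc_op Q opr) Y (assoc_act Y act) A
        (theta_finite n Q opr Y act A \<theta>)"
      using assms(5) theta_finite_cocycle_if_sums_vanish rack_type_period(1)[OF _ assms(3)] by simp
  next
    fix n
    assume N: "N = enat n" and "\<forall>\<alpha>\<in>carrier A. \<alpha> [^]\<^bsub>A\<^esub> the_enat k = \<one>\<^bsub>A\<^esub>"
    then show "shadow_mgr_2cocycle Q (assoc_group N) (assoc_op Q opr) Y (assoc_act Y act) A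
        (theta_finite n Q opr Y act A \<theta>)"
      using assms(5) theta_finite_cocycle_if_exponent[OF _ assms(3)] by simp
  next
    fix n
    assume N: "N = enat n" and "finite (carrier A) \<and> k = enat (order A)"
    then show "shadow_mgr_2cocycle Q (assoc_group N) (assoc_op Q opr) Y (assoc_act Y act) A
        (theta_finite n Q opr Y act A \<theta>)"
      using assms(5) theta_finite_cocycle_if_exponent[OF _ assms(3)] A.pow_order_eq_1 by simp
  qed
qed

end
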